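(* Let $\nu,d\in\mathbb{C}$ with $|\nu|\le 1$ and let $\Phi(z)=\nu z-d$ for all $z\in\mathbb{C}$ be such that the composition operator $C_\Phi$ is bounded on $H_E(\zeta)$. Then $C_\Phi$ is a co-isometry if and only if $d=0$ and $|\nu|=1$.
   Context: Let $\mathbb{N}_0=\mathbb{N}\cup\{0\}$ and let $\zeta=(\zeta_n)_{n\in\mathbb{N}_0}$ be a sequence of positive real numbers with $\lim_{n\to\infty}\zeta_n^{1/n}=\infty$. The weighted Hardy space of entire functions induced by $\zeta$ is the Hilbert space $H_E(\zeta)=\{g(z)=\sum_{n=0}^\infty b_nz^n : \|g\|^2=\sum_{n=0}^\infty |b_n|^2\zeta_n^2<\infty\}$ of entire functions on $\mathbb{C}$, with inner product $\langle g,h\rangle=\sum_{n=0}^\infty b_n\overline{c_n}\zeta_n^2$ for $g(z)=\sum b_nz^n$ and $h(z)=\sum c_nz^n$ in $H_E(\zeta)$. For an entire function $\Phi:\mathbb{C}\to\mathbb{C}$, the composition operator is $C_\Phi f=f\circ\Phi$; it is bounded on $H_E(\zeta)$ if it maps $H_E(\zeta)$ into itself as a bounded linear operator. A bounded linear operator $S$ on a Hilbert space $H$ is a co-isometry if $S^*$ is an isometry, equivalently $SS^*=I_H$. *)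

theory Defs
  imports "HOL-Complex_Analysis.Complex_Analysis"
begin

definition taylor_coeff :: "(complex \<Rightarrow> complex) \<Rightarrow> nat \<Rightarrow> complex" where
  "taylor_coeff g n = fps_nth (fps_expansion g 0) n"

definition HE :: "(nat \<Rightarrow> real) \<Rightarrow> (complex \<Rightarrow> complex) set" where
  "HE \<zeta> = {g. g holomorphic_on UNIV \<and>
     summable (\<lambda>n. (norm (taylor_coeff g n))\<^sup>2 * (\<zeta> n)\<^sup>2)}"

text \<open>For functions in \<open>HE \<zeta>\<close> the following two series converge; the values on
  other functions are irrelevant.\<close>

definition HE_inner ::
    "(nat \<Rightarrow> real) \<Rightarrow> (complex \<Rightarrow> complex) \<Rightarrow> (complex \<Rightarrow> complex) \<Rightarrow> complex" where
  "HE_inner \<zeta> g h =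
     (\<Sum>n. taylor_coeff g n * cnj (taylor_coeff h n) * of_real ((\<zeta> n)\<^sup>2))"

definition HE_norm :: "(nat \<Rightarrow> real) \<Rightarrow> (complex \<Rightarrow> complex) \<Rightarrow> real" where
  "HE_norm \<zeta> g = sqrt (\<Sum>n. (norm (taylor_coeff g n))\<^sup>2 * (\<zeta> n)\<^sup>2)"

text \<open>The weight sequence is only known at the term level, so operators on the Hilbert
  space are total functions whose behaviour is constrained on the carrier \<open>HE \<zeta>\<close> only.\<close>

type_synonym fun_op = "(complex \<Rightarrow> complex) \<Rightarrow> (complex \<Rightarrow> complex)"

definition HE_linear_op :: "(nat \<Rightarrow> real) \<Rightarrow> fun_op \<Rightarrow> bool" where
  "HE_linear_op \<zeta> S \<longleftrightarrow>
     (\<forall>f\<in>HE \<zeta>. S f \<in> HE \<zeta>) \<and>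
     (\<forall>f\<in>HE \<zeta>. \<forall>g\<in>HE \<zeta>. S (\<lambda>z. f z + g z) = (\<lambda>z. S f z + S g z)) \<and>
     (\<forall>c. \<forall>f\<in>HE \<zeta>. S (\<lambda>z. c * f z) = (\<lambda>z. c * S f z))"

definition HE_bounded_op :: "(nat \<Rightarrow> real) \<Rightarrow> fun_op \<Rightarrow> bool" where
  "HE_bounded_op \<zeta> S \<longleftrightarrow>
     HE_linear_op \<zeta> S \<and> (\<exists>C. \<forall>f\<in>HE \<zeta>. HE_norm \<zeta> (S f) \<le> C * HE_norm \<zeta> f)"

definition HE_isometry :: "(nat \<Rightarrow> real) \<Rightarrow> fun_op \<Rightarrow> bool" where
  "HE_isometry \<zeta> S \<longleftrightarrow>
     HE_linear_op \<zeta> S \<and> (\<forall>f\<in>HE \<zeta>. HE_norm \<zeta> (S f) = HE_norm \<zeta> f)"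

definition HE_is_adjoint :: "(nat \<Rightarrow> real) \<Rightarrow> fun_op \<Rightarrow> fun_op \<Rightarrow> bool" where
  "HE_is_adjoint \<zeta> S T \<longleftrightarrow>
     (\<forall>g\<in>HE \<zeta>. T g \<in> HE \<zeta>) \<and>
     (\<forall>f\<in>HE \<zeta>. \<forall>g\<in>HE \<zeta>. HE_inner \<zeta> (S f) g = HE_inner \<zeta> f (T g))"

text \<open>A bounded \<open>S\<close> has exactly one adjoint \<open>T\<close> as far as its values on \<open>HE \<zeta>\<close> are
  concerned, so the existential below just names the adjoint of \<open>S\<close>.\<close>

definition HE_coisometry :: "(nat \<Rightarrow> real) \<Rightarrow> fun_op \<Rightarrow> bool" where
  "HE_coisometry \<zeta> S \<longleftrightarrow>
     HE_bounded_op \<zeta> S \<and> (\<exists>T. HE_is_adjoint \<zeta> S T \<and> HE_isometry \<zeta> T)"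

definition comp_op :: "(complex \<Rightarrow> complex) \<Rightarrow> fun_op" where
  "comp_op \<Phi> f = f \<circ> \<Phi>"

end

theory Submission
  imports Defs
begin

text \<open>
  The kernel \<open>K\<^sub>w(z) = (\<Sum>n. cnj w ^ n * z ^ n / (\<zeta> n)\<^sup>2)\<close> reproduces the value at \<open>w\<close>, so the
  adjoint \<open>T\<close> of a composition operator satisfies \<open>T K\<^sub>w = K\<^bsub>\<Phi> w\<^esub>\<close>. The squared norm of \<open>K\<^sub>w\<close> is
  \<open>(\<Sum>n. (norm w)\<^sup>2 ^ n / (\<zeta> n)\<^sup>2)\<close>, which is strictly increasing in \<open>norm w\<close>. Hence, if \<open>T\<close> is an
  isometry, \<open>norm (\<Phi> w) = norm w\<close> for all \<open>w\<close>, and \<open>w = 0\<close>, \<open>w = 1\<close> give the claim. Conversely,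
  composition with a rotation has composition with the inverse rotation as its adjoint.
\<close>

lemma entire_sums_taylor_coeff:
  assumes "f holomorphic_on UNIV"
  shows "(\<lambda>n. taylor_coeff f n * z ^ n) sums f z"
proof -
  have "(\<lambda>n. (deriv ^^ n) f 0 / fact n * (z - 0) ^ n) sums f z"
    by (rule holomorphic_power_series[where r = "norm z + 1"])
      (use assms holomorphic_on_subset in auto)
  then show ?thesis
    by (simp add: taylor_coeff_def fps_expansion_def)
qed

text \<open>Convergence at every point forces an infinite radius of convergence, so \<open>f\<close>
  is the evaluation of its formal series and hence entire. Uniqueness of the expansion at 0 then
  identifies the coefficients.\<close>

lemma
  assumes "\<And>z. (\<lambda>n. a n * z ^ n) sums f z"
  shows power_series_entire: "f holomorphic_on UNIV"
    and taylor_coeff_eqI: "taylor_coeff f n = a n"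
proof -
  define F where "F = Abs_fps a"
  have "f has_fps_expansion F"
    by (rule has_fps_expansionI) (use assms in \<open>simp add: F_def\<close>)
  then show "taylor_coeff f n = a n"
    by (simp add: taylor_coeff_def fps_expansion_eqI F_def)
  have "fps_conv_radius F = \<infinity>"
    unfolding fps_conv_radius_def F_def
    by (rule conv_radius_inftyI'') (use assms in \<open>auto simp: sums_iff\<close>)
  then have "eval_fps F holomorphic_on UNIV"
    by (intro holomorphic_on_eval_fps) auto
  moreover have "eval_fps F = f"
    using assms by (auto simp: eval_fps_def F_def sums_iff)
  ultimately show "f holomorphic_on UNIV"
    by simp
qed

lemma taylor_coeff_power: "taylor_coeff (\<lambda>z. z ^ m) n = (if n = m then 1 else 0)"
proof (rule taylor_coeff_eqI)
  fix z :: complex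
  show "(\<lambda>n. (if n = m then 1 else 0) * z ^ n) sums z ^ m"
    using sums_single[of m "\<lambda>n. z ^ n"] by (simp add: if_distrib[of "\<lambda>x. x * _"] cong: if_cong)
qed

lemma power_in_HE: "(\<lambda>z. z ^ m) \<in> HE \<zeta>"
  by (auto simp: HE_def taylor_coeff_power intro!: holomorphic_intros summable_finite[of "{m}"]
      split: if_splits)

lemma HE_inner_power_left: "HE_inner \<zeta> (\<lambda>z. z ^ m) g = cnj (taylor_coeff g m) * (\<zeta> m)\<^sup>2"
  unfolding HE_inner_def by (subst suminf_finite[of "{m}"]) (auto simp: taylor_coeff_power split: if_splits)

lemma taylor_coeff_scale:
  assumes "f holomorphic_on UNIV"
  shows "taylor_coeff (comp_op (\<lambda>z. c * z) f) n = c ^ n * taylor_coeff f n"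
proof (rule taylor_coeff_eqI)
  fix z
  show "(\<lambda>n. c ^ n * taylor_coeff f n * z ^ n) sums comp_op (\<lambda>z. c * z) f z"
    using entire_sums_taylor_coeff[OF assms, of "c * z"]
    by (simp add: comp_op_def power_mult_distrib mult_ac)
qed

context
  fixes c :: complex
  assumes norm_c: "norm c = 1"
begin

text \<open>A rotation multiplies the Taylor coefficient of index \<open>n\<close> by
  \<open>c ^ n\<close>, which has modulus 1, so the series defining the norm is unchanged term by
  term.\<close>

lemma comp_op_rotation_in_HE:
  assumes "f \<in> HE \<zeta>"
  shows "comp_op (\<lambda>z. c * z) f \<in> HE \<zeta>"
proof -
  have "f holomorphic_on UNIV"
    using assms by (simp add: HE_def)
  then have "comp_op (\<lambda>z. c * z) f holomorphic_on UNIV"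
    unfolding comp_op_def by (intro holomorphic_on_compose_gen[of _ _ _ UNIV] holomorphic_intros) auto
  then show ?thesis
    using assms by (simp add: HE_def taylor_coeff_scale norm_mult norm_power norm_c)
qed

lemma HE_isometry_rotation: "HE_isometry \<zeta> (comp_op (\<lambda>z. c * z))"
  unfolding HE_isometry_def HE_linear_op_def
proof (intro conjI ballI allI)
  fix f assume f: "f \<in> HE \<zeta>"
  show "comp_op (\<lambda>z. c * z) f \<in> HE \<zeta>"
    using f by (rule comp_op_rotation_in_HE)
  show "HE_norm \<zeta> (comp_op (\<lambda>z. c * z) f) = HE_norm \<zeta> f"
    using f by (simp add: HE_norm_def HE_def taylor_coeff_scale norm_mult norm_power norm_c)
qed (auto simp: comp_op_def o_def)

end

text \<open>In each term of the inner product the factor \<open>c ^ n\<close> can be moved to the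
  second argument, where it appears as the conjugate of \<open>cnj c ^ n\<close>.\<close>

lemma HE_is_adjoint_rotation:
  assumes "norm c = 1"
  shows "HE_is_adjoint \<zeta> (comp_op (\<lambda>z. c * z)) (comp_op (\<lambda>z. cnj c * z))"
  unfolding HE_is_adjoint_def
proof (intro conjI ballI)
  show "comp_op (\<lambda>z. cnj c * z) g \<in> HE \<zeta>" if "g \<in> HE \<zeta>" for g
    using that assms by (intro comp_op_rotation_in_HE) simp_all
  fix f g assume "f \<in> HE \<zeta>" "g \<in> HE \<zeta>"
  then have "f holomorphic_on UNIV" "g holomorphic_on UNIV"
    by (simp_all add: HE_def)
  then show "HE_inner \<zeta> (comp_op (\<lambda>z. c * z) f) g = HE_inner \<zeta> f (comp_op (\<lambda>z. cnj c * z) g)"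
    by (simp add: HE_inner_def taylor_coeff_scale) (simp add: mult_ac)
qed

text \<open>The parameter \<open>w\<close> enters conjugated because \<open>HE_inner\<close>
  conjugates its second argument, the slot in which the kernel is used.\<close>

definition kernel :: "(nat \<Rightarrow> real) \<Rightarrow> complex \<Rightarrow> complex \<Rightarrow> complex" where
  "kernel \<zeta> w z = (\<Sum>n. cnj w ^ n / (\<zeta> n)\<^sup>2 * z ^ n)"

text \<open>The argument \<open>r\<close> stands for the squared modulus of \<open>w\<close>; as a
  function of one real variable the squared kernel norm can be compared by monotonicity.\<close>

definition kernel_norm2 :: "(nat \<Rightarrow> real) \<Rightarrow> real \<Rightarrow> real" where
  "kernel_norm2 \<zeta> r = (\<Sum>n. r ^ n / (\<zeta> n)\<^sup>2)"

context
  fixes \<zeta> :: "nat \<Rightarrow> real"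
  assumes pos: "\<And>n. \<zeta> n > 0"
    and root_lim: "filterlim (\<lambda>n. root n (\<zeta> n)) at_top sequentially"
begin

lemma summable_power_div_weight:
  assumes "r \<ge> 0"
  shows "summable (\<lambda>n. r ^ n / (\<zeta> n)\<^sup>2)"
proof -
  \<comment> \<open>Eventually \<open>\<zeta> n\<close> is at least \<open>(r + 1) ^ n\<close>,
    which bounds the terms by \<open>q ^ n\<close>. The bound \<open>r + 1\<close> on the roots is
    chosen because its square exceeds \<open>r\<close>.\<close>
  define q where "q = r / (r + 1)\<^sup>2"
  have "r < (r + 1)\<^sup>2"
    using assms by (simp add: power2_eq_square algebra_simps add_pos_nonneg)
  then have "norm q < 1"
    using assms by (simp add: q_def)
  then have "summable (\<lambda>n. q ^ n)"
    by (rule summable_geometric)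
  \<comment> \<open>The index 0 is excluded because \<open>root 0\<close> is constantly 0, so its
    power does not recover \<open>\<zeta> 0\<close>.\<close>
  moreover have "eventually (\<lambda>n. norm (r ^ n / (\<zeta> n)\<^sup>2) \<le> q ^ n) sequentially"
    using root_lim[unfolded filterlim_at_top, rule_format, of "r + 1"] eventually_gt_at_top[of 0]
  proof eventually_elim
    case (elim n)
    have "(r + 1) ^ n \<le> root n (\<zeta> n) ^ n"
      using elim assms by (intro power_mono) auto
    also have "\<dots> = \<zeta> n"
      using elim pos[of n] by (simp add: real_root_pow_pos)
    finally have "((r + 1) ^ n)\<^sup>2 \<le> (\<zeta> n)\<^sup>2"
      using assms by (intro power_mono) auto
    then have "r ^ n / (\<zeta> n)\<^sup>2 \<le> r ^ n / ((r + 1) ^ n)\<^sup>2"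
      using assms pos[of n] by (intro divide_left_mono mult_pos_pos) auto
    also have "\<dots> = q ^ n"
      by (simp add: q_def power_divide power_mult[symmetric] mult.commute)
    finally show ?case
      using assms by simp
  qed
  ultimately show ?thesis
    by (rule summable_comparison_test_ev[rotated])
qed

lemma kernel_sums: "(\<lambda>n. cnj w ^ n / (\<zeta> n)\<^sup>2 * z ^ n) sums kernel \<zeta> w z"
  unfolding kernel_def
proof (rule summable_sums, rule summable_norm_cancel)
  show "summable (\<lambda>n. norm (cnj w ^ n / (\<zeta> n)\<^sup>2 * z ^ n))"
    using summable_power_div_weight[of "norm w * norm z"]
    by (simp add: norm_mult norm_divide norm_power power_mult_distrib)
qed

lemma taylor_coeff_kernel: "taylor_coeff (kernel \<zeta> w) n = cnj w ^ n / (\<zeta> n)\<^sup>2"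
  by (rule taylor_coeff_eqI) (rule kernel_sums)

lemma norm_taylor_coeff_kernel:
  "(norm (taylor_coeff (kernel \<zeta> w) n))\<^sup>2 * (\<zeta> n)\<^sup>2 = (norm w)\<^sup>2 ^ n / (\<zeta> n)\<^sup>2"
proof -
  have "norm (taylor_coeff (kernel \<zeta> w) n) = norm w ^ n / (\<zeta> n)\<^sup>2"
    by (simp add: taylor_coeff_kernel norm_divide norm_power)
  moreover have "(norm w ^ n)\<^sup>2 = (norm w)\<^sup>2 ^ n"
    by (simp add: power_mult[symmetric] mult.commute)
  moreover have "(a / b)\<^sup>2 * b = a\<^sup>2 / b" for a b :: real
    by (simp add: power2_eq_square)
  ultimately show ?thesis
    by simp
qed

lemma kernel_in_HE: "kernel \<zeta> w \<in> HE \<zeta>"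
  unfolding HE_def using power_series_entire[OF kernel_sums] summable_power_div_weight
  by (simp add: norm_taylor_coeff_kernel)

lemma HE_norm_kernel: "HE_norm \<zeta> (kernel \<zeta> w) = sqrt (kernel_norm2 \<zeta> ((norm w)\<^sup>2))"
  by (simp add: HE_norm_def kernel_norm2_def norm_taylor_coeff_kernel)

text \<open>The weights cancel termwise and leave the Taylor series of \<open>f\<close> at
  \<open>w\<close>. Stating this for all entire \<open>f\<close> lets it apply to composites known
  only to be holomorphic.\<close>

lemma HE_inner_kernel:
  assumes "f holomorphic_on UNIV"
  shows "HE_inner \<zeta> f (kernel \<zeta> w) = f w"
proof -
  have "\<zeta> n \<noteq> 0" for n
    using pos[of n] by simp
  then show ?thesis
    using sums_unique[OF entire_sums_taylor_coeff[OF assms, of w]]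
    by (simp add: HE_inner_def taylor_coeff_kernel)
qed

lemma kernel_norm2_strict_mono:
  assumes "0 \<le> r" "r < s"
  shows "kernel_norm2 \<zeta> r < kernel_norm2 \<zeta> s"
proof -
  have sm: "summable (\<lambda>n. r ^ n / (\<zeta> n)\<^sup>2)" "summable (\<lambda>n. s ^ n / (\<zeta> n)\<^sup>2)"
    using assms by (auto intro: summable_power_div_weight)
  have "0 < (\<Sum>n. s ^ n / (\<zeta> n)\<^sup>2 - r ^ n / (\<zeta> n)\<^sup>2)"
  \<comment> \<open>The terms of index 0 agree, so strictness comes from index 1.\<close>
  proof (rule suminf_pos2[where i = 1])
    show "0 \<le> s ^ n / (\<zeta> n)\<^sup>2 - r ^ n / (\<zeta> n)\<^sup>2" for n
      using assms by (simp add: divide_right_mono power_mono)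
    show "0 < s ^ 1 / (\<zeta> 1)\<^sup>2 - r ^ 1 / (\<zeta> 1)\<^sup>2"
      using assms pos[of 1] by (simp add: divide_strict_right_mono)
  qed (rule summable_diff[OF sm(2,1)])
  then show ?thesis
    by (simp add: kernel_norm2_def suminf_diff[OF sm(2,1), symmetric])
qed

text \<open>Pairing with a monomial extracts a Taylor coefficient up to conjugation and weight.
  Passing to the adjoint turns this pairing into the value at \<open>w\<close> of the
  \<open>n\<close>-th power of \<open>\<Phi>\<close>.\<close>

lemma taylor_coeff_adjoint_kernel:
  assumes adj: "HE_is_adjoint \<zeta> (comp_op \<Phi>) T" and \<Phi>: "\<Phi> holomorphic_on UNIV"
  shows "taylor_coeff (T (kernel \<zeta> w)) n = taylor_coeff (kernel \<zeta> (\<Phi> w)) n"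
proof -
  have "comp_op \<Phi> (\<lambda>z. z ^ n) holomorphic_on UNIV"
    unfolding comp_op_def o_def by (intro holomorphic_intros \<Phi>)
  then have "\<Phi> w ^ n = HE_inner \<zeta> (comp_op \<Phi> (\<lambda>z. z ^ n)) (kernel \<zeta> w)"
    by (subst HE_inner_kernel) (simp_all add: comp_op_def)
  also have "\<dots> = HE_inner \<zeta> (\<lambda>z. z ^ n) (T (kernel \<zeta> w))"
    using adj power_in_HE kernel_in_HE by (simp add: HE_is_adjoint_def)
  also have "\<dots> = cnj (taylor_coeff (T (kernel \<zeta> w)) n) * (\<zeta> n)\<^sup>2"
    by (rule HE_inner_power_left)
  finally have "cnj (\<Phi> w ^ n) = taylor_coeff (T (kernel \<zeta> w)) n * (\<zeta> n)\<^sup>2"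
    by simp
  then show ?thesis
    using pos[of n] by (simp add: taylor_coeff_kernel)
qed

lemma coisometry_imp_norm_preserving:
  assumes "HE_coisometry \<zeta> (comp_op \<Phi>)" "\<Phi> holomorphic_on UNIV"
  shows "norm (\<Phi> w) = norm w"
proof -
  obtain T where T: "HE_is_adjoint \<zeta> (comp_op \<Phi>) T" "HE_isometry \<zeta> T"
    using assms(1) by (auto simp: HE_coisometry_def)
  \<comment> \<open>The norm depends only on Taylor coefficients, so their agreement is enough
    here.\<close>
  have "HE_norm \<zeta> (kernel \<zeta> (\<Phi> w)) = HE_norm \<zeta> (T (kernel \<zeta> w))"
    by (simp add: HE_norm_def taylor_coeff_adjoint_kernel[OF T(1) assms(2)])
  also have "\<dots> = HE_norm \<zeta> (kernel \<zeta> w)"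
    using T(2) kernel_in_HE by (simp add: HE_isometry_def)
  finally have "kernel_norm2 \<zeta> ((norm (\<Phi> w))\<^sup>2) = kernel_norm2 \<zeta> ((norm w)\<^sup>2)"
    by (simp add: HE_norm_kernel)
  \<comment> \<open>Strict monotonicity makes \<open>kernel_norm2\<close> injective on nonnegative
    arguments.\<close>
  then have "(norm (\<Phi> w))\<^sup>2 = (norm w)\<^sup>2"
    by (metis kernel_norm2_strict_mono less_irrefl linorder_neqE zero_le_power2)
  then show ?thesis
    by simp
qed

end

theorem theorem3p1:
  fixes \<zeta> :: "nat \<Rightarrow> real" and \<nu> d :: complex and \<Phi> :: "complex \<Rightarrow> complex"
  assumes "\<And>n. \<zeta> n > 0"
    and "filterlim (\<lambda>n. root n (\<zeta> n)) at_top sequentially"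
    and "norm \<nu> \<le> 1"
    and "\<And>z. \<Phi> z = \<nu> * z - d"
    and "HE_bounded_op \<zeta> (comp_op \<Phi>)"
  shows "HE_coisometry \<zeta> (comp_op \<Phi>) \<longleftrightarrow> d = 0 \<and> norm \<nu> = 1"
proof
  assume co: "HE_coisometry \<zeta> (comp_op \<Phi>)"
  have "\<Phi> = (\<lambda>z. \<nu> * z - d)"
    using assms(4) by auto
  then have "\<Phi> holomorphic_on UNIV"
    by (auto intro!: holomorphic_intros)
  then have "norm (\<Phi> w) = norm w" for w
    by (rule coisometry_imp_norm_preserving[OF assms(1,2) co])
  \<comment> \<open>The value of \<open>\<Phi>\<close> at 0 is \<open>- d\<close>, whose modulus
    must vanish; then the value at 1 is \<open>\<nu>\<close>, of modulus 1.\<close>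
  from this[of 0] this[of 1] show "d = 0 \<and> norm \<nu> = 1"
    by (simp add: assms(4))
next
  assume rot: "d = 0 \<and> norm \<nu> = 1"
  then have \<Phi>: "\<Phi> = (\<lambda>z. \<nu> * z)"
    using assms(4) by auto
  have "HE_is_adjoint \<zeta> (comp_op \<Phi>) (comp_op (\<lambda>z. cnj \<nu> * z))"
    unfolding \<Phi> using rot by (intro HE_is_adjoint_rotation) simp
  moreover have "HE_isometry \<zeta> (comp_op (\<lambda>z. cnj \<nu> * z))"
    using rot by (intro HE_isometry_rotation) simp
  ultimately show "HE_coisometry \<zeta> (comp_op \<Phi>)"
    using assms(5) by (auto simp: HE_coisometry_def)
qed

end
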